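(* Let $\mathcal H$ be a Hilbert space, let $\mathsf G_{\mathcal H}$ be a group of linear isometric isomorphisms of $\mathcal H$, let $D\subset\mathcal H$ and $L\ge0$. Suppose that $f:D\to\mathcal H$ is $L$-Lipschitz and $\mathsf G_{\mathcal H}$-invariant. Then there exists an $L$-Lipschitz map $\hat f:\mathcal H\to\mathcal H$ extending $f$ which is $\mathsf G_{\mathcal H}$-invariant as well.
   Context: A map $f:D\to\mathcal H$, $D\subset\mathcal H$, is $\mathsf G_{\mathcal H}$-invariant if for every $x\in D$ and every $U\in\mathsf G_{\mathcal H}$ one has $Ux\in D$ and $f(Ux)=Uf(x)$. "$L$-Lipschitz" means $|f(x)-f(y)|\le L|x-y|$ for all $x,y\in D$. *)

theory Defs
  imports "HOL-Analysis.Analysis" "HOL-Algebra.Bij"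
begin

(* Bijectivity of the members of G is part of being a subgroup of BijGroup UNIV, whose
   operation is composition of maps. *)
definition linear_isometry_group :: "('a::real_normed_vector \<Rightarrow> 'a) set \<Rightarrow> bool" where
  "linear_isometry_group G \<longleftrightarrow>
     subgroup G (BijGroup UNIV) \<and> (\<forall>U\<in>G. linear U \<and> (\<forall>x. norm (U x) = norm x))"

(* A map D -> 'a is a total function whose values outside D are irrelevant. *)
definition invariant_map_on ::
    "('a \<Rightarrow> 'a) set \<Rightarrow> 'a set \<Rightarrow> ('a \<Rightarrow> 'a) \<Rightarrow> bool" where
  "invariant_map_on G D f \<longleftrightarrow> (\<forall>x\<in>D. \<forall>U\<in>G. U x \<in> D \<and> f (U x) = U (f x))"

end

theory Submission
  imports Defs
begin

text \<open>
  The Lipschitz extension is produced by a formula in which no choice is made, so that it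
  inherits every symmetry of the data; this is the reason for avoiding the usual argument that
  extends a map point by point.

  For nonempty \<open>D\<close> look for a function \<open>F\<close> on \<open>H \<times> H\<close> whose gradient is \<open>L\<close>-Lipschitz and which
  satisfies \<open>F (z, 0) = 0\<close> and \<open>\<nabla>F (z, 0) = (0, f z)\<close> for \<open>z \<in> D\<close>. Then
  \<open>x \<mapsto> \<nabla>\<^sub>y F (x, 0)\<close> is an \<open>L\<close>-Lipschitz extension of \<open>f\<close>.
  Any such \<open>F\<close> lies, for each \<open>z\<close>, between the two paraboloids with leading coefficient
  \<open>\<plusminus> L/2\<close> that are tangent to it at \<open>(z, 0)\<close>. After \<open>L/2 * |X|\<^sup>2\<close> is added, the
  lower paraboloids become affine functions (\<open>lower_paraboloid\<close>) and the upper ones become affine functions plus \<open>L * |X|\<^sup>2\<close>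
  (\<open>upper_paraboloid\<close>). The Lipschitz condition on \<open>f\<close> guarantees that every lower one
  is below every upper one (\<open>lower_paraboloid_le_upper_paraboloid\<close>).
  The potential used here is the largest convex function below all the upper ones
  (\<open>kirszbraun_potential\<close>). Being the largest, it dominates the lower paraboloids, which are
  affine; so it has the right value and vertical gradient at \<open>(z, 0)\<close>.

  Two general facts make this work. First, the convex envelope of a function \<open>g\<close> for which
  \<open>K * |X|\<^sup>2 - g\<close> is convex has the same property (\<open>semiconcave_convex_envelope\<close>).
  Second, a function that is convex and semiconcave in this sense has at every point a
  linear differential with a quadratic error bound (\<open>quadratically_tangent_exists\<close>), and comparing
  the bounds at two points \<open>(x, 0)\<close> and \<open>(y, 0)\<close> gives the Lipschitz estimate for the vertical
  gradient with the sharp constant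
  (\<open>quadratically_tangent_diff\<close>). The Riesz representation theorem turns
  the vertical part of the differential into a vector.
  If a group of linear isometries preserves \<open>D\<close> and \<open>f\<close>, it permutes the upper paraboloids; hence
  it preserves their convex envelope and commutes with its vertical gradient.
\<close>

section \<open>Semiconcave functions and convex envelopes\<close>

lemma norm_convex_combination:
  fixes a b :: "'a::real_inner"
  assumes "u + v = 1"
  shows "u * (norm a)\<^sup>2 + v * (norm b)\<^sup>2 - (norm (u *\<^sub>R a + v *\<^sub>R b))\<^sup>2 = u * v * (norm (a - b))\<^sup>2"
proof -
  have v: "v = 1 - u" using assms by simp
  show ?thesis
    unfolding v power2_norm_eq_inner
    by (simp add: inner_simps inner_commute[of b a] algebra_simps power2_eq_square)
qed

text \<open>Convexity of \<open>K * |x|\<^sup>2 - g\<close> in the form of a concavity inequality for \<open>g\<close> with a quadratic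
  defect; the defect depends only on \<open>a - b\<close>, so it is invariant under translations.\<close>

lemma convex_on_square_minus_iff:
  fixes g :: "'a::real_inner \<Rightarrow> real"
  shows "convex_on UNIV (\<lambda>x. K * (norm x)\<^sup>2 - g x) \<longleftrightarrow>
    (\<forall>a b u v. 0 \<le> u \<longrightarrow> 0 \<le> v \<longrightarrow> u + v = 1 \<longrightarrow>
      u * g a + v * g b \<le> g (u *\<^sub>R a + v *\<^sub>R b) + K * (u * v * (norm (a - b))\<^sup>2))"
proof -
  have "(K * (norm (u *\<^sub>R a + v *\<^sub>R b))\<^sup>2 - g (u *\<^sub>R a + v *\<^sub>R b)
          \<le> u * (K * (norm a)\<^sup>2 - g a) + v * (K * (norm b)\<^sup>2 - g b)) \<longleftrightarrow>
        (u * g a + v * g b \<le> g (u *\<^sub>R a + v *\<^sub>R b) + K * (u * v * (norm (a - b))\<^sup>2))"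
    if "u + v = 1" for a b u v
    unfolding norm_convex_combination[OF that, symmetric] by (simp add: algebra_simps)
  then show ?thesis
    unfolding convex_on_def by auto
qed

definition convex_envelope :: "('a::real_vector \<Rightarrow> real) \<Rightarrow> 'a \<Rightarrow> real" where
  "convex_envelope g x = (SUP c\<in>{c. convex_on UNIV c \<and> (\<forall>y. c y \<le> g y)}. c x)"

lemma convex_envelope_greatest:
  assumes "convex_on UNIV c" and "\<And>y. c y \<le> g y"
  shows "c x \<le> convex_envelope g x"
  unfolding convex_envelope_def
proof (rule cSUP_upper)
  show "bdd_above ((\<lambda>c. c x) ` {c. convex_on UNIV c \<and> (\<forall>y. c y \<le> g y)})"
    by (rule bdd_aboveI2[where M = "g x"]) auto
qed (use assms in auto)

lemma convex_envelope_least: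
  assumes "convex_on UNIV c0" and "\<And>y. c0 y \<le> g y"
    and "\<And>c. convex_on UNIV c \<Longrightarrow> (\<And>y. c y \<le> g y) \<Longrightarrow> c x \<le> B"
  shows "convex_envelope g x \<le> B"
  unfolding convex_envelope_def using assms by (intro cSUP_least) auto

lemma convex_envelope_le:
  assumes "convex_on UNIV c0" and "\<And>y. c0 y \<le> g y"
  shows "convex_envelope g x \<le> g x"
  using assms by (rule convex_envelope_least) auto

lemma convex_on_convex_envelope:
  assumes "convex_on UNIV c0" and "\<And>y. c0 y \<le> g y"
  shows "convex_on UNIV (convex_envelope g)"
  unfolding convex_on_def
proof (intro conjI ballI allI impI)
  fix x y :: 'a and u v :: real
  assume uv: "0 \<le> u" "0 \<le> v" "u + v = 1"
  show "convex_envelope g (u *\<^sub>R x + v *\<^sub>R y) \<le> u * convex_envelope g x + v * convex_envelope g y"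
  proof (rule convex_envelope_least[OF assms])
    fix c :: "'a \<Rightarrow> real"
    assume c: "convex_on UNIV c" "\<And>y. c y \<le> g y"
    have "c (u *\<^sub>R x + v *\<^sub>R y) \<le> u * c x + v * c y"
      using c(1) uv unfolding convex_on_def by auto
    also have "\<dots> \<le> u * convex_envelope g x + v * convex_envelope g y"
      using uv convex_envelope_greatest[OF c] by (intro add_mono mult_left_mono) auto
    finally show "c (u *\<^sub>R x + v *\<^sub>R y) \<le> u * convex_envelope g x + v * convex_envelope g y" .
  qed
qed auto

lemma convex_on_affine_compose:
  assumes "convex_on UNIV c" and "linear T"
  shows "convex_on UNIV (\<lambda>x. c (T x + d))"
  unfolding convex_on_def
proof (intro conjI ballI allI impI)
  fix x y and u v :: real
  assume uv: "0 \<le> u" "0 \<le> v" "u + v = 1"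
  have "T (u *\<^sub>R x + v *\<^sub>R y) + d = u *\<^sub>R T x + v *\<^sub>R T y + (u + v) *\<^sub>R d"
    using \<open>linear T\<close> uv by (simp add: linear_add linear_scale)
  also have "\<dots> = u *\<^sub>R (T x + d) + v *\<^sub>R (T y + d)"
    by (simp add: algebra_simps)
  finally show "c (T (u *\<^sub>R x + v *\<^sub>R y) + d) \<le> u * c (T x + d) + v * c (T y + d)"
    using assms(1) uv unfolding convex_on_def by simp
qed auto

text \<open>The composition of the envelope with \<open>T\<close> competes in the supremum that defines the envelope.\<close>

lemma convex_envelope_linear_le:
  assumes "convex_on UNIV c0" and "\<And>y. c0 y \<le> g y"
    and "linear T" and "\<And>x. g (T x) \<le> g x"
  shows "convex_envelope g (T x) \<le> convex_envelope g x"
proof (rule convex_envelope_greatest[where c = "\<lambda>x. convex_envelope g (T x)"])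
  show "convex_on UNIV (\<lambda>x. convex_envelope g (T x))"
    using convex_on_affine_compose[OF convex_on_convex_envelope[OF assms(1,2)] \<open>linear T\<close>, of 0]
    by simp
  show "convex_envelope g (T y) \<le> g y" for y
    using convex_envelope_le[OF assms(1,2), of "T y"] assms(4)[of y] by linarith
qed

text \<open>The weighted average of two translates of the envelope, lowered by the semiconcavity defect
  of \<open>g\<close>, is again a convex function below \<open>g\<close>. By maximality it is below the envelope; evaluated at
  \<open>u *\<^sub>R a + v *\<^sub>R b\<close> this is the semiconcavity inequality of the envelope.\<close>

lemma semiconcave_convex_envelope:
  fixes g :: "'a::real_inner \<Rightarrow> real"
  assumes minorant: "convex_on UNIV c0" "\<And>y. c0 y \<le> g y"
    and g: "convex_on UNIV (\<lambda>x. K * (norm x)\<^sup>2 - g x)"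
  shows "convex_on UNIV (\<lambda>x. K * (norm x)\<^sup>2 - convex_envelope g x)"
  unfolding convex_on_square_minus_iff
proof (intro allI impI)
  fix a b :: 'a and u v :: real
  assume uv: "0 \<le> u" "0 \<le> v" "u + v = 1"
  let ?e = "convex_envelope g"
  define h where "h = a - b"
  define c where "c x = u * ?e (x + v *\<^sub>R h) + v * ?e (x + - u *\<^sub>R h) + - (K * (u * v * (norm h)\<^sup>2))"
    for x
  have shift: "convex_on UNIV (\<lambda>x. ?e (x + d))" for d
    using convex_on_affine_compose[OF convex_on_convex_envelope[OF minorant] linear_ident] by simp
  have "convex_on UNIV c"
    unfolding c_def using uv
    by (intro convex_on_add convex_on_cmul shift) (auto simp: convex_on_const)
  moreover have "c x \<le> g x" for x
  proof -
    have "u *\<^sub>R (x + v *\<^sub>R h) + v *\<^sub>R (x + - u *\<^sub>R h) = (u + v) *\<^sub>R x"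
      by (simp add: algebra_simps)
    then have mid: "u *\<^sub>R (x + v *\<^sub>R h) + v *\<^sub>R (x + - u *\<^sub>R h) = x"
      using uv by simp
    have "(x + v *\<^sub>R h) - (x + - u *\<^sub>R h) = (u + v) *\<^sub>R h"
      by (simp add: algebra_simps)
    then have diff: "(x + v *\<^sub>R h) - (x + - u *\<^sub>R h) = h"
      using uv by simp
    have "u * ?e (x + v *\<^sub>R h) + v * ?e (x + - u *\<^sub>R h)
        \<le> u * g (x + v *\<^sub>R h) + v * g (x + - u *\<^sub>R h)"
      using uv by (intro add_mono mult_left_mono convex_envelope_le[OF minorant])
    also have "\<dots> \<le> g x + K * (u * v * (norm h)\<^sup>2)"
      using g[unfolded convex_on_square_minus_iff, rule_format, OF uv,
          of "x + v *\<^sub>R h" "x + - u *\<^sub>R h"]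
      unfolding mid diff .
    finally show ?thesis by (simp add: c_def)
  qed
  ultimately have "c (u *\<^sub>R a + v *\<^sub>R b) \<le> ?e (u *\<^sub>R a + v *\<^sub>R b)"
    by (rule convex_envelope_greatest)
  moreover have "u *\<^sub>R a + v *\<^sub>R b + v *\<^sub>R h = (u + v) *\<^sub>R a"
    "u *\<^sub>R a + v *\<^sub>R b + - u *\<^sub>R h = (u + v) *\<^sub>R b"
    by (simp_all add: h_def algebra_simps)
  ultimately show "u * ?e a + v * ?e b
      \<le> ?e (u *\<^sub>R a + v *\<^sub>R b) + K * (u * v * (norm (a - b))\<^sup>2)"
    using uv by (simp add: c_def h_def)
qed

section \<open>Differentials with a quadratic error bound\<close>

text \<open>For convex \<open>\<phi>\<close> the difference quotient is increasing in \<open>t\<close>, so this infimum is the limit as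
  \<open>t\<close> decreases to \<open>0\<close>.\<close>

definition right_derivative :: "('a::real_vector \<Rightarrow> real) \<Rightarrow> 'a \<Rightarrow> 'a \<Rightarrow> real" where
  "right_derivative \<phi> x h = (INF t\<in>{0<..}. (\<phi> (x + t *\<^sub>R h) - \<phi> x) / t)"

lemma convex_quotient_mono:
  fixes \<phi> :: "'a::real_vector \<Rightarrow> real"
  assumes "convex_on UNIV \<phi>" and st: "0 < s" "s \<le> t"
  shows "(\<phi> (x + s *\<^sub>R h) - \<phi> x) / s \<le> (\<phi> (x + t *\<^sub>R h) - \<phi> x) / t"
proof -
  have eq: "x + s *\<^sub>R h = (1 - s / t) *\<^sub>R x + (s / t) *\<^sub>R (x + t *\<^sub>R h)"
    using st by (simp add: algebra_simps)
  have "\<phi> (x + s *\<^sub>R h) \<le> (1 - s / t) * \<phi> x + (s / t) * \<phi> (x + t *\<^sub>R h)"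
    unfolding eq using st by (intro convex_onD[OF assms(1)]) auto
  then have "\<phi> (x + s *\<^sub>R h) - \<phi> x \<le> s * ((\<phi> (x + t *\<^sub>R h) - \<phi> x) / t)"
    by (simp add: algebra_simps diff_divide_distrib)
  then show ?thesis
    using st by (simp add: pos_divide_le_eq mult.commute)
qed

lemma convex_quotient_ge:
  fixes \<phi> :: "'a::real_vector \<Rightarrow> real"
  assumes "convex_on UNIV \<phi>" and t: "0 < t"
  shows "\<phi> x - \<phi> (x - h) \<le> (\<phi> (x + t *\<^sub>R h) - \<phi> x) / t"
proof -
  define s where "s = 1 / (1 + t)"
  have s: "0 \<le> s" "s \<le> 1" "s * (1 + t) = 1" using t by (auto simp: s_def)
  have "(1 - s) *\<^sub>R (x - h) + s *\<^sub>R (x + t *\<^sub>R h) = x + (s * (1 + t) - 1) *\<^sub>R h"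
    by (simp add: algebra_simps)
  then have eq: "(1 - s) *\<^sub>R (x - h) + s *\<^sub>R (x + t *\<^sub>R h) = x"
    using s by simp
  have "\<phi> x \<le> (1 - s) * \<phi> (x - h) + s * \<phi> (x + t *\<^sub>R h)"
    using convex_onD[OF assms(1) s(1,2), of "x - h" "x + t *\<^sub>R h"] unfolding eq by simp
  then have "(1 + t) * \<phi> x \<le> (1 + t) * ((1 - s) * \<phi> (x - h) + s * \<phi> (x + t *\<^sub>R h))"
    using t by (intro mult_left_mono) auto
  also have "\<dots> = (1 + t - s * (1 + t)) * \<phi> (x - h) + s * (1 + t) * \<phi> (x + t *\<^sub>R h)"
    by (simp add: algebra_simps)
  also have "\<dots> = t * \<phi> (x - h) + \<phi> (x + t *\<^sub>R h)"
    using s by simp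
  finally have "(\<phi> x - \<phi> (x - h)) * t \<le> \<phi> (x + t *\<^sub>R h) - \<phi> x"
    by (simp add: algebra_simps)
  then show ?thesis
    using t by (simp add: pos_le_divide_eq)
qed

lemma right_derivative_le:
  assumes "convex_on UNIV \<phi>" and "0 < t"
  shows "right_derivative \<phi> x h \<le> (\<phi> (x + t *\<^sub>R h) - \<phi> x) / t"
  unfolding right_derivative_def
proof (rule cINF_lower)
  show "bdd_below ((\<lambda>t. (\<phi> (x + t *\<^sub>R h) - \<phi> x) / t) ` {0<..})"
    by (rule bdd_belowI2[where m = "\<phi> x - \<phi> (x - h)"]) (simp add: convex_quotient_ge[OF assms(1)])
qed (use assms in auto)

lemma tendsto_right_derivative:
  assumes "convex_on UNIV \<phi>"
  shows "((\<lambda>t. (\<phi> (x + t *\<^sub>R h) - \<phi> x) / t) \<longlongrightarrow> right_derivative \<phi> x h) (at_right 0)"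
proof (rule order_tendstoI)
  fix b assume "b < right_derivative \<phi> x h"
  then have "b < (\<phi> (x + t *\<^sub>R h) - \<phi> x) / t" if "0 < t" for t
    using right_derivative_le[OF assms that, of x h] by linarith
  then show "\<forall>\<^sub>F t in at_right 0. b < (\<phi> (x + t *\<^sub>R h) - \<phi> x) / t"
    unfolding eventually_at_right_field by (auto intro: exI[of _ 1])
next
  fix b assume "right_derivative \<phi> x h < b"
  then obtain t where t: "0 < t" "(\<phi> (x + t *\<^sub>R h) - \<phi> x) / t < b"
  proof -
    have "bdd_below ((\<lambda>t. (\<phi> (x + t *\<^sub>R h) - \<phi> x) / t) ` {0<..})"
      by (rule bdd_belowI2[where m = "\<phi> x - \<phi> (x - h)"]) (simp add: convex_quotient_ge[OF assms])
    with \<open>right_derivative \<phi> x h < b\<close> show thesis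
      unfolding right_derivative_def using that by (subst (asm) cINF_less_iff) auto
  qed
  have "(\<phi> (x + s *\<^sub>R h) - \<phi> x) / s < b" if "0 < s" "s < t" for s
    using convex_quotient_mono[OF assms, of s t x h] that t by simp
  then show "\<forall>\<^sub>F s in at_right 0. (\<phi> (x + s *\<^sub>R h) - \<phi> x) / s < b"
    unfolding eventually_at_right_field using t by auto
qed

lemma filterlim_scale_at_right_0:
  fixes c :: real
  assumes "0 < c"
  shows "filterlim (\<lambda>t. c * t) (at_right 0) (at_right 0)"
proof -
  have "((\<lambda>t. c * t) \<longlongrightarrow> c * 0) (at_right 0)"
    by (intro tendsto_intros)
  then show ?thesis
    using assms by (auto simp: filterlim_at eventually_at_right_field intro!: exI[of _ 1])
qed

lemma right_derivative_scale:
  assumes "convex_on UNIV \<phi>" and "0 < c"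
  shows "right_derivative \<phi> x (c *\<^sub>R h) = c * right_derivative \<phi> x h"
proof (rule tendsto_unique[OF _ tendsto_right_derivative[OF assms(1)]])
  have "((\<lambda>t. (\<phi> (x + (c * t) *\<^sub>R h) - \<phi> x) / (c * t)) \<longlongrightarrow> right_derivative \<phi> x h) (at_right 0)"
    using filterlim_compose[OF tendsto_right_derivative[OF assms(1)] filterlim_scale_at_right_0[OF assms(2)]] .
  then have "((\<lambda>t. c * ((\<phi> (x + (c * t) *\<^sub>R h) - \<phi> x) / (c * t))) \<longlongrightarrow> c * right_derivative \<phi> x h)
      (at_right 0)"
    by (rule tendsto_mult_left)
  then show "((\<lambda>t. (\<phi> (x + t *\<^sub>R c *\<^sub>R h) - \<phi> x) / t) \<longlongrightarrow> c * right_derivative \<phi> x h) (at_right 0)"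
    using \<open>0 < c\<close> by (simp add: mult.commute[of c])
qed auto

lemma right_derivative_subadditive:
  assumes "convex_on UNIV \<phi>"
  shows "right_derivative \<phi> x (h + k) \<le> right_derivative \<phi> x h + right_derivative \<phi> x k"
proof (rule tendsto_le[OF _ _ tendsto_right_derivative[OF assms]])
  let ?q = "\<lambda>h t. (\<phi> (x + t *\<^sub>R h) - \<phi> x) / t"
  show "((\<lambda>t. ?q h (2 * t) + ?q k (2 * t)) \<longlongrightarrow>
      right_derivative \<phi> x h + right_derivative \<phi> x k) (at_right 0)"
    by (intro tendsto_add filterlim_compose[OF tendsto_right_derivative[OF assms]]
        filterlim_scale_at_right_0) auto
  have "?q (h + k) t \<le> ?q h (2 * t) + ?q k (2 * t)" if "0 < t" for t
  proof -
    have eq: "x + t *\<^sub>R (h + k)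
        = (1 - 1/2) *\<^sub>R (x + (2 * t) *\<^sub>R h) + (1/2) *\<^sub>R (x + (2 * t) *\<^sub>R k)"
    proof -
      have "x = (1/2) *\<^sub>R x + (1/2) *\<^sub>R x"
        by (simp flip: scaleR_add_left)
      then show ?thesis by (simp add: scaleR_add_right)
    qed
    have "\<phi> (x + t *\<^sub>R (h + k))
        \<le> (1 - 1/2) * \<phi> (x + (2 * t) *\<^sub>R h) + (1/2) * \<phi> (x + (2 * t) *\<^sub>R k)"
      unfolding eq by (intro convex_onD[OF assms]) auto
    then have "(\<phi> (x + t *\<^sub>R (h + k)) - \<phi> x) / t
        \<le> ((\<phi> (x + (2 * t) *\<^sub>R h) - \<phi> x + (\<phi> (x + (2 * t) *\<^sub>R k) - \<phi> x)) / 2) / t"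
      using that by (intro divide_right_mono) auto
    then show ?thesis
      by (simp flip: add_divide_distrib)
  qed
  then show "\<forall>\<^sub>F t in at_right 0. ?q (h + k) t \<le> ?q h (2 * t) + ?q k (2 * t)"
    unfolding eventually_at_right_field by (auto intro: exI[of _ 1])
qed auto

definition quadratically_tangent ::
    "real \<Rightarrow> ('a::real_normed_vector \<Rightarrow> real) \<Rightarrow> 'a \<Rightarrow> ('a \<Rightarrow> real) \<Rightarrow> bool" where
  "quadratically_tangent K \<phi> x d \<longleftrightarrow> linear d \<and>
     (\<forall>h. \<phi> x + d h \<le> \<phi> (x + h) \<and> \<phi> (x + h) \<le> \<phi> x + d h + K * (norm h)\<^sup>2)"

text \<open>Both \<open>\<phi>\<close> and \<open>\<psi> = K * |x|\<^sup>2 - \<phi>\<close> are convex, so both have subadditive right derivatives. These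
  add up to the derivative of \<open>K * |x|\<^sup>2\<close>, which is linear; hence each of them is linear. The
  supporting inequality for \<open>\<phi>\<close> is the lower bound and the one for \<open>\<psi>\<close> is the upper bound.\<close>

lemma quadratically_tangent_exists:
  fixes \<phi> :: "'a::real_inner \<Rightarrow> real"
  assumes \<phi>: "convex_on UNIV \<phi>" and \<psi>: "convex_on UNIV (\<lambda>x. K * (norm x)\<^sup>2 - \<phi> x)"
  shows "\<exists>d. quadratically_tangent K \<phi> x d"
proof -
  let ?\<psi> = "\<lambda>x. K * (norm x)\<^sup>2 - \<phi> x"
  define d where "d = right_derivative \<phi> x"
  define e where "e = right_derivative ?\<psi> x"
  have square: "(norm (x + h))\<^sup>2 = (norm x)\<^sup>2 + 2 * inner x h + (norm h)\<^sup>2" for h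
    by (simp add: power2_norm_eq_inner inner_simps inner_commute)
  have sum: "d h + e h = 2 * K * inner x h" for h
  proof (rule tendsto_unique)
    show "((\<lambda>t. (\<phi> (x + t *\<^sub>R h) - \<phi> x) / t + (?\<psi> (x + t *\<^sub>R h) - ?\<psi> x) / t) \<longlongrightarrow> d h + e h) (at_right 0)"
      unfolding d_def e_def by (intro tendsto_add tendsto_right_derivative \<phi> \<psi>)
    have "((\<lambda>t. 2 * K * inner x h + t * (K * (norm h)\<^sup>2)) \<longlongrightarrow> 2 * K * inner x h + 0 * (K * (norm h)\<^sup>2)) (at_right 0)"
      by (intro tendsto_intros)
    moreover have "2 * K * inner x h + t * (K * (norm h)\<^sup>2)
        = (\<phi> (x + t *\<^sub>R h) - \<phi> x) / t + (?\<psi> (x + t *\<^sub>R h) - ?\<psi> x) / t" if "0 < t" for t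
      using that unfolding square by (simp add: field_simps power2_eq_square)
    then have "\<forall>\<^sub>F t in at_right 0. 2 * K * inner x h + t * (K * (norm h)\<^sup>2)
        = (\<phi> (x + t *\<^sub>R h) - \<phi> x) / t + (?\<psi> (x + t *\<^sub>R h) - ?\<psi> x) / t"
      unfolding eventually_at_right_field by (intro exI[of _ 1]) auto
    ultimately show "((\<lambda>t. (\<phi> (x + t *\<^sub>R h) - \<phi> x) / t + (?\<psi> (x + t *\<^sub>R h) - ?\<psi> x) / t)
        \<longlongrightarrow> 2 * K * inner x h) (at_right 0)"
      by (simp add: tendsto_cong)
  qed simp
  have add: "d (h + k) = d h + d k" for h k
  proof (rule antisym)
    show "d (h + k) \<le> d h + d k"
      unfolding d_def by (rule right_derivative_subadditive[OF \<phi>])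
    have "e (h + k) \<le> e h + e k"
      unfolding e_def by (rule right_derivative_subadditive[OF \<psi>])
    then show "d h + d k \<le> d (h + k)"
      using sum[of h] sum[of k] sum[of "h + k"] by (simp add: inner_simps algebra_simps)
  qed
  have zero: "d 0 = 0" using add[of 0 0] by simp
  have neg: "d (- h) = - d h" for h using add[of h "- h"] zero by simp
  have pos: "d (c *\<^sub>R h) = c * d h" if "0 < c" for c h
    unfolding d_def by (rule right_derivative_scale[OF \<phi> that])
  have scale: "d (c *\<^sub>R h) = c * d h" for c h
  proof (cases c "0 :: real" rule: linorder_cases)
    case less
    then show ?thesis using pos[of "- c" "h"] neg[of "c *\<^sub>R h"] by simp
  qed (auto simp: zero pos)
  have "linear d"
    using add scale by (auto intro: linearI)
  moreover have "\<phi> x + d h \<le> \<phi> (x + h)" for h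
    using right_derivative_le[OF \<phi>, of 1 x h] by (simp add: d_def)
  moreover have "\<phi> (x + h) \<le> \<phi> x + d h + K * (norm h)\<^sup>2" for h
    using right_derivative_le[OF \<psi>, of 1 x h, folded e_def] sum[of h]
    unfolding square by (simp add: algebra_simps)
  ultimately show ?thesis
    unfolding quadratically_tangent_def by blast
qed

text \<open>Expand \<open>\<phi>\<close> at the two points \<open>(x + y)/2 \<plusminus> v\<close>, from \<open>x\<close> and from \<open>y\<close>. Using the upper bound
  from one base point and the lower bound from the other, with the roles exchanged for the
  second point, cancels the values of \<open>\<phi>\<close> and all terms in the direction \<open>y - x\<close>.\<close>

lemma quadratically_tangent_diff:
  fixes \<phi> :: "'a::real_inner \<Rightarrow> real"
  assumes x: "quadratically_tangent K \<phi> x d" and y: "quadratically_tangent K \<phi> y e"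
  shows "e v - d v \<le> K * (norm ((1/2) *\<^sub>R (y - x) + v))\<^sup>2"
proof -
  define a where "a = (1/2) *\<^sub>R (y - x)"
  have a2: "a + a = y - x"
    unfolding a_def by (simp flip: scaleR_add_left)
  have pts: "y + (- a + w) = x + (a + w)" for w
    using a2 by (simp add: algebra_simps)
  have lin: "linear d" "linear e"
    using x y by (auto simp: quadratically_tangent_def)
  have x_le: "\<phi> x + d h \<le> \<phi> (x + h)" "\<phi> (x + h) \<le> \<phi> x + d h + K * (norm h)\<^sup>2" for h
    using x by (auto simp: quadratically_tangent_def)
  have "\<phi> y + e h \<le> \<phi> (y + h)" "\<phi> (y + h) \<le> \<phi> y + e h + K * (norm h)\<^sup>2" for h
    using y by (auto simp: quadratically_tangent_def)
  from this(1)[of "- a + v"] this(2)[of "- a + - v"]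
  have "\<phi> y + e (- a + v) \<le> \<phi> (x + (a + v))"
    "\<phi> (x + (a + - v)) \<le> \<phi> y + e (- a + - v) + K * (norm (- a + - v))\<^sup>2"
    unfolding pts .
  moreover note x_le(2)[of "a + v"] x_le(1)[of "a + - v"]
  moreover have "norm (- a + - v) = norm (a + v)"
    using norm_minus_cancel[of "a + v"] by simp
  ultimately have "e v - d v \<le> K * (norm (a + v))\<^sup>2"
    unfolding linear_add[OF lin(1)] linear_add[OF lin(2)] linear_neg[OF lin(1)] linear_neg[OF lin(2)]
    by simp
  then show ?thesis by (simp add: a_def)
qed

section \<open>Representing functionals by vectors\<close>

text \<open>The representing vector minimises \<open>|v|\<^sup>2 - 2 * d v\<close>; by the parallelogram law every minimising
  sequence is Cauchy.\<close>

lemma riesz_representation: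
  fixes d :: "'a::{real_inner, complete_space} \<Rightarrow> real"
  assumes "bounded_linear d"
  shows "\<exists>a. \<forall>v. d v = inner a v"
proof -
  interpret bounded_linear d by fact
  define J where "J v = (norm v)\<^sup>2 - 2 * d v" for v
  define m where "m = (INF v. J v)"
  obtain C where C: "\<And>v. norm (d v) \<le> norm v * C"
    using bounded by blast
  have "- C\<^sup>2 \<le> J v" for v
  proof -
    have "0 \<le> (norm v - C)\<^sup>2" by simp
    then show ?thesis
      using C[of v] by (simp add: J_def power2_diff)
  qed
  then have bdd: "bdd_below (range J)"
    by (rule bdd_belowI2)
  then have m_le: "m \<le> J v" for v
    unfolding m_def by (rule cINF_lower) simp
  have "\<exists>v. J v < m + inverse (real (Suc n))" for n
    using cINF_less_iff[OF _ bdd, of "m + inverse (real (Suc n))"] by (auto simp: m_def)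
  then obtain X where X: "\<And>n. J (X n) < m + inverse (real (Suc n))"
    by metis
  have parallelogram: "(norm (b - c))\<^sup>2 \<le> 2 * (J b - m) + 2 * (J c - m)" for b c
  proof -
    have "J ((1/2) *\<^sub>R (b + c)) = (norm (b + c))\<^sup>2 / 4 - d b - d c"
      by (simp add: J_def scale add power_divide add_divide_distrib)
    moreover have "(norm (b - c))\<^sup>2 + (norm (b + c))\<^sup>2 = 2 * (norm b)\<^sup>2 + 2 * (norm c)\<^sup>2"
      by (simp add: power2_norm_eq_inner inner_simps inner_commute)
    ultimately show ?thesis
      using m_le[of "(1/2) *\<^sub>R (b + c)"] by (simp add: J_def)
  qed
  have "Cauchy X"
  proof (rule metric_CauchyI)
    fix \<epsilon> :: real assume "0 < \<epsilon>"
    then obtain N where N: "inverse (real (Suc N)) < \<epsilon>\<^sup>2 / 4"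
      using reals_Archimedean[of "\<epsilon>\<^sup>2 / 4"] by auto
    have near: "J (X n) - m < \<epsilon>\<^sup>2 / 4" if "N \<le> n" for n
    proof -
      have "inverse (real (Suc n)) \<le> inverse (real (Suc N))"
        using that by (simp add: divide_simps)
      then show ?thesis using X[of n] N by linarith
    qed
    have "dist (X k) (X n) < \<epsilon>" if "N \<le> k" "N \<le> n" for k n
    proof (rule power2_less_imp_less)
      have "(norm (X k - X n))\<^sup>2 \<le> 2 * (J (X k) - m) + 2 * (J (X n) - m)"
        by (rule parallelogram)
      also have "\<dots> < 2 * (\<epsilon>\<^sup>2 / 4) + 2 * (\<epsilon>\<^sup>2 / 4)"
        using near[OF that(1)] near[OF that(2)] by (intro add_strict_mono) auto
      finally show "(dist (X k) (X n))\<^sup>2 < \<epsilon>\<^sup>2"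
        by (simp add: dist_norm)
    qed (use \<open>0 < \<epsilon>\<close> in simp)
    then show "\<exists>N. \<forall>k\<ge>N. \<forall>n\<ge>N. dist (X k) (X n) < \<epsilon>" by blast
  qed
  then obtain a where a: "X \<longlonglongrightarrow> a"
    using Cauchy_convergent convergent_def by blast
  then have "(\<lambda>n. J (X n)) \<longlonglongrightarrow> J a"
    unfolding J_def by (intro tendsto_intros tendsto)
  moreover have "(\<lambda>n. m + inverse (real (Suc n))) \<longlonglongrightarrow> m + 0"
    by (intro tendsto_intros LIMSEQ_inverse_real_of_nat)
  ultimately have "J a \<le> m + 0"
    by (rule LIMSEQ_le) (use X less_imp_le in blast)
  then have min: "J a \<le> J w" for w
    using m_le[of w] by linarith
  have "d v = inner a v" for v
  proof (cases "v = 0")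
    case False
    define \<delta> where "\<delta> = d v - inner a v"
    define t where "t = \<delta> / (norm v)\<^sup>2"
    have t: "t * (norm v)\<^sup>2 = \<delta>" using False by (simp add: t_def)
    have "J (a + t *\<^sub>R v) = J a - 2 * t * \<delta> + t * (t * (norm v)\<^sup>2)"
      by (simp add: J_def \<delta>_def add scale power2_norm_eq_inner inner_simps
          inner_commute[of v a] algebra_simps)
    then have "t * \<delta> \<le> 0"
      using min[of "a + t *\<^sub>R v"] unfolding t by (simp add: mult.commute)
    then have "\<delta>\<^sup>2 / (norm v)\<^sup>2 \<le> 0"
      by (simp add: t_def power2_eq_square)
    then have "\<delta> = 0"
      using False by (simp add: divide_le_0_iff)
    then show ?thesis by (simp add: \<delta>_def)
  qed (simp add: zero)
  then show ?thesis by blast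
qed

lemma bounded_linear_if_bounded_above:
  fixes d :: "'a::real_normed_vector \<Rightarrow> real"
  assumes "linear d" and C: "\<And>v. norm v \<le> 1 \<Longrightarrow> d v \<le> C"
  shows "bounded_linear d"
proof -
  interpret linear d by fact
  have half: "d v \<le> norm v * C" for v
  proof (cases "v = 0")
    case False
    have "d v = norm v * d (sgn v)"
      using False by (simp add: sgn_div_norm scale)
    also have "\<dots> \<le> norm v * C"
      by (intro mult_left_mono C) (auto simp: norm_sgn)
    finally show ?thesis .
  qed (simp add: zero)
  have "norm (d v) \<le> norm v * C" for v
    using half[of v] half[of "- v"] by (simp add: neg abs_le_iff)
  then show ?thesis
    by (intro bounded_linear_intro[where K = C] add scale) auto
qed

section \<open>The potential of a Lipschitz map\<close>

text \<open>The functions \<open>w \<bullet> y \<plusminus> L/2 * (|x - z|\<^sup>2 + |y|\<^sup>2)\<close> touch at \<open>(z, 0)\<close>, where both have value \<open>0\<close> and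
  gradient \<open>(0, w)\<close>. The following two functions are these paraboloids after the addition of
  \<open>L/2 * |X|\<^sup>2\<close>, which cancels the quadratic part of the lower one.\<close>

definition lower_paraboloid :: "real \<Rightarrow> 'a \<Rightarrow> 'b \<Rightarrow> 'a::real_inner \<times> 'b::real_inner \<Rightarrow> real" where
  "lower_paraboloid L z w X = L * inner z (fst X) + inner w (snd X) - L / 2 * (norm z)\<^sup>2"

definition upper_paraboloid :: "real \<Rightarrow> 'a \<Rightarrow> 'b \<Rightarrow> 'a::real_inner \<times> 'b::real_inner \<Rightarrow> real" where
  "upper_paraboloid L z w X =
     L * (norm X)\<^sup>2 - L * inner z (fst X) + inner w (snd X) + L / 2 * (norm z)\<^sup>2"

lemma norm_prod_square:
  fixes X :: "'a::real_normed_vector \<times> 'b::real_normed_vector"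
  shows "(norm X)\<^sup>2 = (norm (fst X))\<^sup>2 + (norm (snd X))\<^sup>2"
  by (simp add: norm_prod_def)

text \<open>With \<open>X = (x, y)\<close> the difference of the two sides is
  \<open>L * |x - (z + z')/2|\<^sup>2 + L/4 * |z - z'|\<^sup>2 + (w - w') \<bullet> y + L * |y|\<^sup>2\<close>, and the last three terms are
  at least \<open>L * (|z - z'|/2 - |y|)\<^sup>2\<close> by the Cauchy-Schwarz inequality.\<close>

lemma lower_paraboloid_le_upper_paraboloid:
  assumes L: "0 \<le> L" and lip: "norm (w - w') \<le> L * norm (z - z')"
  shows "lower_paraboloid L z' w' X \<le> upper_paraboloid L z w X"
proof -
  obtain x y where X: "X = (x, y)" by fastforce
  define m where "m = (1/2) *\<^sub>R (z + z')"
  have "- inner (w - w') y \<le> norm (w - w') * norm y"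
    using norm_cauchy_schwarz[of "- (w - w')" y] by (simp add: inner_simps norm_minus_commute)
  also have "\<dots> \<le> L * norm (z - z') * norm y"
    using lip by (rule mult_right_mono) simp
  finally have cs: "0 \<le> inner (w - w') y + L * norm (z - z') * norm y" by simp
  have sq: "0 \<le> L * (norm (x - m))\<^sup>2" "0 \<le> L * (norm (z - z') / 2 - norm y)\<^sup>2"
    using L by simp_all
  have m: "(norm (x - m))\<^sup>2 + (norm (z - z'))\<^sup>2 / 4
      = (norm x)\<^sup>2 - inner z x - inner z' x + (norm z)\<^sup>2 / 2 + (norm z')\<^sup>2 / 2"
    unfolding m_def power2_norm_eq_inner
    by (simp add: inner_simps inner_commute field_simps)
  have "upper_paraboloid L z w X - lower_paraboloid L z' w' X
     = L * ((norm x)\<^sup>2 - inner z x - inner z' x + (norm z)\<^sup>2 / 2 + (norm z')\<^sup>2 / 2)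
       + inner (w - w') y + L * (norm y)\<^sup>2"
    unfolding X upper_paraboloid_def lower_paraboloid_def norm_prod_square
    by (simp add: inner_simps algebra_simps)
  also have "\<dots> = L * (norm (x - m))\<^sup>2 + L * (norm (z - z') / 2 - norm y)\<^sup>2
      + (inner (w - w') y + L * norm (z - z') * norm y)"
    unfolding m[symmetric] by (simp add: power2_diff power_divide algebra_simps)
  finally show ?thesis using cs sq by linarith
qed

lemma convex_on_lower_paraboloid: "convex_on UNIV (lower_paraboloid L z w)"
  unfolding convex_on_def
proof (intro conjI ballI allI impI)
  fix X Y and u v :: real
  assume "u + v = 1"
  then have v: "v = 1 - u" by simp
  show "lower_paraboloid L z w (u *\<^sub>R X + v *\<^sub>R Y)
      \<le> u * lower_paraboloid L z w X + v * lower_paraboloid L z w Y"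
    unfolding lower_paraboloid_def v by (simp add: inner_simps field_simps)
qed auto

lemma upper_paraboloid_convex_combination:
  assumes "u + v = 1"
  shows "u * upper_paraboloid L z w X + v * upper_paraboloid L z w Y
    = upper_paraboloid L z w (u *\<^sub>R X + v *\<^sub>R Y) + L * (u * v * (norm (X - Y))\<^sup>2)"
proof -
  have v: "v = 1 - u" using assms by simp
  show ?thesis
    unfolding norm_convex_combination[OF assms, symmetric] unfolding upper_paraboloid_def v
    by (simp add: inner_simps field_simps)
qed

definition inf_upper_paraboloids ::
    "real \<Rightarrow> 'a set \<Rightarrow> ('a \<Rightarrow> 'b) \<Rightarrow> 'a::real_inner \<times> 'b::real_inner \<Rightarrow> real" where
  "inf_upper_paraboloids L D f X = (INF z\<in>D. upper_paraboloid L z (f z) X)"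

definition kirszbraun_potential ::
    "real \<Rightarrow> 'a set \<Rightarrow> ('a \<Rightarrow> 'b) \<Rightarrow> 'a::real_inner \<times> 'b::real_inner \<Rightarrow> real" where
  "kirszbraun_potential L D f = convex_envelope (inf_upper_paraboloids L D f)"

definition vertical_gradient ::
    "real \<Rightarrow> ('a::zero \<times> 'b::real_inner \<Rightarrow> real) \<Rightarrow> 'a \<Rightarrow> 'b \<Rightarrow> bool" where
  "vertical_gradient K \<phi> x a \<longleftrightarrow> (\<forall>v. \<phi> (x, 0) + inner a v \<le> \<phi> (x, v) \<and>
     \<phi> (x, v) \<le> \<phi> (x, 0) + inner a v + K * (norm v)\<^sup>2)"

definition kirszbraun_extension ::
    "real \<Rightarrow> 'a set \<Rightarrow> ('a \<Rightarrow> 'b) \<Rightarrow> 'a::real_inner \<Rightarrow> 'b::real_inner" where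
  "kirszbraun_extension L D f x = (THE a. vertical_gradient L (kirszbraun_potential L D f) x a)"

lemma vertical_gradient_unique:
  assumes "vertical_gradient K \<phi> x a" and "vertical_gradient K \<phi> x b"
  shows "a = b"
proof (rule ccontr)
  assume "a \<noteq> b"
  then have pos: "0 < (norm (a - b))\<^sup>2" by simp
  \<comment> \<open>Along \<open>a - b\<close> the linear terms differ by \<open>t * |a - b|\<^sup>2\<close>, which beats the error
    \<open>K * t\<^sup>2 * |a - b|\<^sup>2\<close> for small \<open>t\<close>.\<close>
  define t where "t = 1 / (\<bar>K\<bar> + 1)"
  have t: "0 < t" "K * t < 1" by (auto simp: t_def field_simps)
  have "inner a (t *\<^sub>R (a - b)) \<le> inner b (t *\<^sub>R (a - b)) + K * (norm (t *\<^sub>R (a - b)))\<^sup>2"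
    using assms unfolding vertical_gradient_def by (smt (verit))
  moreover have "inner a (t *\<^sub>R (a - b)) - inner b (t *\<^sub>R (a - b)) = t * (norm (a - b))\<^sup>2"
    by (simp only: power2_norm_eq_inner inner_scaleR_right inner_diff_left right_diff_distrib)
  moreover have "K * (norm (t *\<^sub>R (a - b)))\<^sup>2 = t * (K * t * (norm (a - b))\<^sup>2)"
    by (simp add: power_mult_distrib power2_eq_square[of t])
  ultimately have "t * (norm (a - b))\<^sup>2 \<le> t * (K * t * (norm (a - b))\<^sup>2)"
    by linarith
  then have "(norm (a - b))\<^sup>2 \<le> K * t * (norm (a - b))\<^sup>2"
    using t by simp
  then show False
    using mult_strict_right_mono[OF t(2) pos] by simp
qed

lemma kirszbraun_extension_eqI:
  assumes "vertical_gradient L (kirszbraun_potential L D f) x a"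
  shows "kirszbraun_extension L D f x = a"
  unfolding kirszbraun_extension_def
  using assms vertical_gradient_unique by (intro the_equality)

context
  fixes L :: real and D :: "'a::real_inner set" and f :: "'a \<Rightarrow> 'b::{real_inner, complete_space}"
  assumes lipschitz: "L-lipschitz_on D f" and nonempty: "D \<noteq> {}"
begin

lemma lower_paraboloid_le:
  assumes "z \<in> D" and "z' \<in> D"
  shows "lower_paraboloid L z' (f z') X \<le> upper_paraboloid L z (f z) X"
  using lipschitz_onD[OF lipschitz assms] lipschitz_on_nonneg[OF lipschitz]
  by (intro lower_paraboloid_le_upper_paraboloid) (auto simp: dist_norm)

lemma inf_upper_paraboloids_le:
  assumes "z \<in> D"
  shows "inf_upper_paraboloids L D f X \<le> upper_paraboloid L z (f z) X"
  unfolding inf_upper_paraboloids_def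
proof (rule cINF_lower)
  show "bdd_below ((\<lambda>z. upper_paraboloid L z (f z) X) ` D)"
    using lower_paraboloid_le[OF _ assms] by (rule bdd_belowI2)
qed fact

lemma le_inf_upper_paraboloids:
  assumes "\<And>z. z \<in> D \<Longrightarrow> B \<le> upper_paraboloid L z (f z) X"
  shows "B \<le> inf_upper_paraboloids L D f X"
  unfolding inf_upper_paraboloids_def using nonempty assms by (rule cINF_greatest)

lemma lower_paraboloid_le_inf:
  assumes "z \<in> D"
  shows "lower_paraboloid L z (f z) X \<le> inf_upper_paraboloids L D f X"
  using assms lower_paraboloid_le by (intro le_inf_upper_paraboloids)

lemma semiconcave_inf_upper_paraboloids:
  "convex_on UNIV (\<lambda>X. L * (norm X)\<^sup>2 - inf_upper_paraboloids L D f X)"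
  unfolding convex_on_square_minus_iff
proof (intro allI impI)
  fix X Y :: "'a \<times> 'b" and u v :: real
  assume uv: "0 \<le> u" "0 \<le> v" "u + v = 1"
  let ?g = "inf_upper_paraboloids L D f"
  have "u * ?g X + v * ?g Y - L * (u * v * (norm (X - Y))\<^sup>2) \<le> ?g (u *\<^sub>R X + v *\<^sub>R Y)"
  proof (rule le_inf_upper_paraboloids)
    fix z assume "z \<in> D"
    then have "u * ?g X + v * ?g Y
        \<le> u * upper_paraboloid L z (f z) X + v * upper_paraboloid L z (f z) Y"
      using uv by (intro add_mono mult_left_mono inf_upper_paraboloids_le)
    then show "u * ?g X + v * ?g Y - L * (u * v * (norm (X - Y))\<^sup>2)
        \<le> upper_paraboloid L z (f z) (u *\<^sub>R X + v *\<^sub>R Y)"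
      unfolding upper_paraboloid_convex_combination[OF uv(3)] by simp
  qed
  then show "u * ?g X + v * ?g Y \<le> ?g (u *\<^sub>R X + v *\<^sub>R Y) + L * (u * v * (norm (X - Y))\<^sup>2)"
    by simp
qed

lemma inf_upper_paraboloids_minorant:
  obtains c where "convex_on UNIV c" and "\<And>X. c X \<le> inf_upper_paraboloids L D f X"
  using nonempty convex_on_lower_paraboloid lower_paraboloid_le_inf by blast

lemma kirszbraun_potential_le:
  assumes "z \<in> D"
  shows "kirszbraun_potential L D f X \<le> upper_paraboloid L z (f z) X"
proof -
  obtain c where c: "convex_on UNIV c" "\<And>X. c X \<le> inf_upper_paraboloids L D f X"
    by (rule inf_upper_paraboloids_minorant) (rule that)
  show ?thesis
    using convex_envelope_le[OF c] inf_upper_paraboloids_le[OF assms]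
    unfolding kirszbraun_potential_def by (rule order_trans)
qed

lemma kirszbraun_potential_ge:
  assumes "z \<in> D"
  shows "lower_paraboloid L z (f z) X \<le> kirszbraun_potential L D f X"
  unfolding kirszbraun_potential_def
  using convex_on_lower_paraboloid lower_paraboloid_le_inf[OF assms]
  by (rule convex_envelope_greatest)

lemma kirszbraun_extension_tangent:
  "\<exists>d. quadratically_tangent L (kirszbraun_potential L D f) (x, 0) d \<and>
     (\<forall>v. d (0, v) = inner (kirszbraun_extension L D f x) v)"
proof -
  let ?\<psi> = "kirszbraun_potential L D f"
  obtain c where c: "convex_on UNIV c" "\<And>X. c X \<le> inf_upper_paraboloids L D f X"
    by (rule inf_upper_paraboloids_minorant) (rule that)
  obtain d where d: "quadratically_tangent L ?\<psi> (x, 0) d"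
    using quadratically_tangent_exists[OF convex_on_convex_envelope[OF c]
        semiconcave_convex_envelope[OF c semiconcave_inf_upper_paraboloids]]
    unfolding kirszbraun_potential_def by blast
  have tangent: "?\<psi> (x, 0) + d (0, v) \<le> ?\<psi> (x, v)"
    "?\<psi> (x, v) \<le> ?\<psi> (x, 0) + d (0, v) + L * (norm v)\<^sup>2" for v
    using d[unfolded quadratically_tangent_def, THEN conjunct2, rule_format, of "(0, v)"]
    by (simp_all add: norm_Pair)
  obtain z where z: "z \<in> D" using nonempty by blast
  have L: "0 \<le> L" using lipschitz by (rule lipschitz_on_nonneg)
  have "bounded_linear (\<lambda>v. d (0, v))"
  proof (rule bounded_linear_if_bounded_above)
    have "linear d" using d by (simp add: quadratically_tangent_def)
    moreover have "linear (\<lambda>v::'b. (0::'a, v))" by (auto intro: linearI)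
    ultimately show "linear (\<lambda>v. d (0, v))"
      using linear_compose by (fastforce simp: o_def)
    fix v :: 'b assume v: "norm v \<le> 1"
    have "(norm v)\<^sup>2 \<le> 1" using v by (simp add: power_le_one)
    then have "L * (norm v)\<^sup>2 \<le> L" using L mult_left_mono[of "(norm v)\<^sup>2" 1 L] by simp
    moreover have "inner (f z) v \<le> norm (f z)"
      using norm_cauchy_schwarz[of "f z" v] mult_left_mono[OF v, of "norm (f z)"] by simp
    moreover have "?\<psi> (x, v) \<le> upper_paraboloid L z (f z) (x, v)"
      using z by (rule kirszbraun_potential_le)
    ultimately show "d (0, v) \<le> L * (norm x)\<^sup>2 + L - L * inner z x + norm (f z)
        + L / 2 * (norm z)\<^sup>2 - ?\<psi> (x, 0)"
      using tangent(1)[of v] by (simp add: upper_paraboloid_def norm_prod_square algebra_simps)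
  qed
  then obtain a where a: "\<And>v. d (0, v) = inner a v"
    using riesz_representation by blast
  then have "vertical_gradient L ?\<psi> x a"
    using tangent by (simp add: vertical_gradient_def)
  then have "kirszbraun_extension L D f x = a"
    by (rule kirszbraun_extension_eqI)
  then show ?thesis using d a by blast
qed

lemma vertical_gradient_kirszbraun_extension:
  "vertical_gradient L (kirszbraun_potential L D f) x (kirszbraun_extension L D f x)"
  unfolding vertical_gradient_def
proof
  fix v
  obtain d where d: "quadratically_tangent L (kirszbraun_potential L D f) (x, 0) d"
    "\<And>v. d (0, v) = inner (kirszbraun_extension L D f x) v"
    using kirszbraun_extension_tangent by blast
  show "kirszbraun_potential L D f (x, 0) + inner (kirszbraun_extension L D f x) v
      \<le> kirszbraun_potential L D f (x, v) \<and> kirszbraun_potential L D f (x, v)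
      \<le> kirszbraun_potential L D f (x, 0) + inner (kirszbraun_extension L D f x) v + L * (norm v)\<^sup>2"
    using d(1)[unfolded quadratically_tangent_def, THEN conjunct2, rule_format, of "(0, v)"]
    by (simp add: norm_Pair d(2))
qed

text \<open>At \<open>(z, 0)\<close> the two paraboloids of \<open>z\<close> have the common value \<open>L/2 * |z|\<^sup>2\<close> and the common
  vertical gradient \<open>f z\<close>, which they impose on the potential between them.\<close>

lemma kirszbraun_extension_eq:
  assumes "z \<in> D"
  shows "kirszbraun_extension L D f z = f z"
proof (rule kirszbraun_extension_eqI)
  let ?\<psi> = "kirszbraun_potential L D f"
  have bounds: "L / 2 * (norm z)\<^sup>2 + inner (f z) v \<le> ?\<psi> (z, v)"
    "?\<psi> (z, v) \<le> L / 2 * (norm z)\<^sup>2 + inner (f z) v + L * (norm v)\<^sup>2" for v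
    using kirszbraun_potential_le[OF assms, of "(z, v)"] kirszbraun_potential_ge[OF assms, of "(z, v)"]
    by (simp_all add: upper_paraboloid_def lower_paraboloid_def norm_prod_square
        power2_norm_eq_inner[of z] algebra_simps)
  have "?\<psi> (z, 0) = L / 2 * (norm z)\<^sup>2"
    using bounds[of 0] by simp
  then show "vertical_gradient L ?\<psi> z (f z)"
    unfolding vertical_gradient_def using bounds by presburger
qed

text \<open>The displacement between the base points is horizontal and the test vector \<open>v\<close> is vertical,
  so the two are orthogonal and the estimate for the differentials becomes
  \<open>\<delta> \<bullet> v \<le> L * (|x - y|\<^sup>2/4 + |v|\<^sup>2)\<close>, where \<open>\<delta>\<close> is the difference of the values at \<open>x\<close> and \<open>y\<close>.
  For \<open>L > 0\<close> the best \<open>v\<close> is \<open>\<delta>/(2 * L)\<close>.\<close>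

lemma lipschitz_kirszbraun_extension: "L-lipschitz_on UNIV (kirszbraun_extension L D f)"
proof (rule lipschitz_onI)
  show L: "0 \<le> L" using lipschitz by (rule lipschitz_on_nonneg)
  fix x y :: 'a
  define \<delta> where "\<delta> = kirszbraun_extension L D f x - kirszbraun_extension L D f y"
  have est: "inner \<delta> v \<le> L * ((norm (x - y))\<^sup>2 / 4 + (norm v)\<^sup>2)" for v
  proof -
    obtain d where d: "quadratically_tangent L (kirszbraun_potential L D f) (x, 0) d"
      "\<And>v. d (0, v) = inner (kirszbraun_extension L D f x) v"
      using kirszbraun_extension_tangent by blast
    obtain e where e: "quadratically_tangent L (kirszbraun_potential L D f) (y, 0) e"
      "\<And>v. e (0, v) = inner (kirszbraun_extension L D f y) v"
      using kirszbraun_extension_tangent by blast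
    have "d (0, v) - e (0, v) \<le> L * (norm ((1/2) *\<^sub>R ((x, 0) - (y, 0)) + (0, v)))\<^sup>2"
      using e(1) d(1) by (rule quadratically_tangent_diff)
    then show ?thesis
      by (simp add: d(2) e(2) \<delta>_def inner_diff_left norm_prod_square power_divide)
  qed
  have "(norm \<delta>)\<^sup>2 \<le> (L * norm (x - y))\<^sup>2"
  proof (cases "L = 0")
    case True
    then show ?thesis using est[of \<delta>] by (simp add: power2_norm_eq_inner)
  next
    case False
    with L have "0 < L" by simp
    define v where "v = (1 / (2 * L)) *\<^sub>R \<delta>"
    have "inner \<delta> v = (norm \<delta>)\<^sup>2 / (2 * L)"
      by (simp add: v_def power2_norm_eq_inner)
    moreover have "L * (norm v)\<^sup>2 = (norm \<delta>)\<^sup>2 / (4 * L)"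
      using \<open>0 < L\<close> by (simp add: v_def power_divide power_mult_distrib power2_eq_square[of L])
    ultimately have "(norm \<delta>)\<^sup>2 / (2 * L) \<le> L * (norm (x - y))\<^sup>2 / 4 + (norm \<delta>)\<^sup>2 / (4 * L)"
      using est[of v] by (simp add: distrib_left)
    then show ?thesis
      using \<open>0 < L\<close> by (simp add: field_simps power2_eq_square)
  qed
  then have "norm \<delta> \<le> L * norm (x - y)"
    by (rule power2_le_imp_le) (use L in simp)
  then show "dist (kirszbraun_extension L D f x) (kirszbraun_extension L D f y) \<le> L * dist x y"
    by (simp add: dist_norm \<delta>_def)
qed

section \<open>Equivariance\<close>

text \<open>The pair \<open>(U, V)\<close> maps the upper paraboloid of \<open>z\<close> to the upper paraboloid of \<open>U z\<close>, so
  composition with it does not increase their infimum. For an invertible pair whose inverse also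
  satisfies the hypotheses, the resulting inequality is an equality.\<close>

lemma kirszbraun_potential_isometry_le:
  assumes U: "linear U" "\<And>x y. inner (U x) (U y) = inner x y"
    and V: "linear V" "\<And>x y. inner (V x) (V y) = inner x y"
    and f: "\<And>z. z \<in> D \<Longrightarrow> U z \<in> D \<and> f (U z) = V (f z)"
  shows "kirszbraun_potential L D f (U x, V y) \<le> kirszbraun_potential L D f (x, y)"
proof -
  obtain c where c: "convex_on UNIV c" "\<And>X. c X \<le> inf_upper_paraboloids L D f X"
    by (rule inf_upper_paraboloids_minorant) (rule that)
  have "linear (map_prod U V)"
    using U(1) V(1) by (auto intro!: linearI simp: linear_add linear_scale)
  moreover have "inf_upper_paraboloids L D f (map_prod U V X) \<le> inf_upper_paraboloids L D f X" for X
  proof (rule le_inf_upper_paraboloids)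
    fix z assume z: "z \<in> D"
    have "inf_upper_paraboloids L D f (map_prod U V X)
        \<le> upper_paraboloid L (U z) (f (U z)) (map_prod U V X)"
      using f[OF z] by (intro inf_upper_paraboloids_le) auto
    also have "\<dots> = upper_paraboloid L z (f z) X"
      using f[OF z] by (simp add: upper_paraboloid_def norm_prod_square power2_norm_eq_inner U(2) V(2))
    finally show "inf_upper_paraboloids L D f (map_prod U V X) \<le> upper_paraboloid L z (f z) X" .
  qed
  ultimately have "convex_envelope (inf_upper_paraboloids L D f) (map_prod U V (x, y))
      \<le> convex_envelope (inf_upper_paraboloids L D f) (x, y)"
    by (rule convex_envelope_linear_le[OF c])
  then show ?thesis
    by (simp add: kirszbraun_potential_def)
qed

end

lemma linear_isometry_inner:
  assumes "linear U" and "\<And>x. norm (U x) = norm x"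
  shows "inner (U x) (U y) = inner x y"
  using assms(2)[of "x + y"] by (simp add: dot_norm assms(2) linear_add[OF assms(1), symmetric])

lemma linear_isometry_group_inverse:
  assumes "linear_isometry_group G" and "U \<in> G"
  obtains V where "V \<in> G" and "\<And>x. U (V x) = x" and "\<And>x. V (U x) = x"
proof
  have G: "subgroup G (BijGroup UNIV)"
    using assms(1) by (simp add: linear_isometry_group_def)
  then have "U \<in> Bij UNIV"
    using assms(2) subgroup.subset by (force simp: BijGroup_def)
  then have bij: "bij U" and "inv\<^bsub>BijGroup UNIV\<^esub> U = inv_into UNIV U"
    by (auto simp: Bij_def inv_BijGroup)
  then show "inv_into UNIV U \<in> G"
    using subgroup.m_inv_closed[OF G assms(2)] by simp
  show "U (inv_into UNIV U x) = x" "inv_into UNIV U (U x) = x" for x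
    using bij by (simp_all add: bij_is_surj surj_f_inv_f bij_is_inj)
qed

theorem theorem2p13:
  fixes G :: "('a::{real_inner, complete_space} \<Rightarrow> 'a) set"
    and D :: "'a set" and L :: real and f :: "'a \<Rightarrow> 'a"
  assumes "linear_isometry_group G"
    and "L \<ge> 0"
    and "L-lipschitz_on D f"
    and "invariant_map_on G D f"
  shows "\<exists>g :: 'a \<Rightarrow> 'a. L-lipschitz_on UNIV g \<and> (\<forall>x\<in>D. g x = f x) \<and> invariant_map_on G UNIV g"
proof -
  have lin: "linear U" and norm: "\<And>x. norm (U x) = norm x" if "U \<in> G" for U
    using assms(1) that by (auto simp: linear_isometry_group_def)
  have inner: "inner (U x) (U y) = inner x y" if "U \<in> G" for U x y
    using lin[OF that] norm[OF that] by (rule linear_isometry_inner)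
  show ?thesis
  proof (cases "D = {}")
    case True
    \<comment> \<open>There are no paraboloids to build a potential from; the zero map commutes with every linear map.\<close>
    have "L-lipschitz_on UNIV (\<lambda>_::'a. 0::'a)"
      using assms(2) by (intro lipschitz_onI) auto
    moreover have "invariant_map_on G UNIV (\<lambda>_. 0)"
      using lin linear_0 by (force simp: invariant_map_on_def)
    ultimately show ?thesis using True by blast
  next
    case False
    let ?\<psi> = "kirszbraun_potential L D f" and ?g = "kirszbraun_extension L D f"
    have le: "?\<psi> (U x, U y) \<le> ?\<psi> (x, y)" if "U \<in> G" for U x y
      using assms(3) False lin[OF that] inner[OF that] lin[OF that] inner[OF that]
    proof (rule kirszbraun_potential_isometry_le)
      show "U z \<in> D \<and> f (U z) = U (f z)" if "z \<in> D" for z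
        using assms(4) \<open>U \<in> G\<close> that by (simp add: invariant_map_on_def)
    qed
    have "?g (U x) = U (?g x)" if U: "U \<in> G" for U x
    proof (rule kirszbraun_extension_eqI)
      obtain V where V: "V \<in> G" "\<And>x. U (V x) = x" "\<And>x. V (U x) = x"
        by (rule linear_isometry_group_inverse[OF assms(1) U]) (rule that)
      have invariant: "?\<psi> (U x, v) = ?\<psi> (x, V v)" for v
        using le[OF U, of x "V v"] le[OF V(1), of "U x" v] by (simp add: V)
      have adjoint: "inner (U (?g x)) v = inner (?g x) (V v)" for v
        using inner[OF U, of "?g x" "V v"] by (simp add: V)
      have "vertical_gradient L ?\<psi> x (?g x)"
        using assms(3) False by (rule vertical_gradient_kirszbraun_extension)
      then have "?\<psi> (x, 0) + inner (?g x) (V v) \<le> ?\<psi> (x, V v) \<and>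
          ?\<psi> (x, V v) \<le> ?\<psi> (x, 0) + inner (?g x) (V v) + L * (norm (V v))\<^sup>2" for v
        unfolding vertical_gradient_def by blast
      then show "vertical_gradient L ?\<psi> (U x) (U (?g x))"
        by (simp add: vertical_gradient_def invariant adjoint norm[OF V(1)] linear_0[OF lin[OF V(1)]])
    qed
    then have "invariant_map_on G UNIV ?g"
      by (simp add: invariant_map_on_def)
    then show ?thesis
      using lipschitz_kirszbraun_extension[OF assms(3) False] kirszbraun_extension_eq[OF assms(3) False]
      by blast
  qed
qed

end
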